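(* Let $p(x), q(x)$ be monic real-rooted polynomials of degree $n$. Then, for every $x \in \mathbb{R}$, $$\big((p \boxplus_n q)(x)\big)^2 \ge (p^2 \boxplus_{2n} q^2)(x),$$ $$\big((p \boxtimes_n q)(x)\big)^2 \ge (p^2 \boxtimes_{2n} q^2)(x).$$
   Context: For complex univariate polynomials $p(x) = \sum_{i=0}^n x^{n-i}(-1)^i a_i$ and $q(x) = \sum_{i=0}^n x^{n-i}(-1)^i b_i$ of degree at most $n$, the $n$th finite free additive convolution is $$(p \boxplus_n q)(x) = \sum_{k=0}^n x^{n-k}(-1)^k \sum_{\substack{0\le i,j\le k\\ i+j=k}} \frac{(n-i)!(n-j)!}{n!(n-k)!} a_i b_j,$$ and the $n$th finite free multiplicative convolution is $$(p \boxtimes_n q)(x) = \sum_{i=0}^n x^{n-i}(-1)^i \frac{a_i b_i}{\binom{n}{i}}.$$ Here $p^2,q^2$ are the ordinary squares (products) of polynomials, of degree $2n$. A real-rooted polynomial is one with all complex roots real. *)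

theory Defs
  imports Complex_Main "HOL-Computational_Algebra.Polynomial"
begin

text \<open>
  The coefficient \<open>a\<^sub>i\<close> in the signed expansion
  \<open>p(x) = (\<Sum>i\<le>n. (-1)^i * a\<^sub>i * x^(n-i))\<close> of a polynomial of degree at most \<open>n\<close>.
  It depends on \<open>n\<close> and is only meaningful for \<open>i \<le> n\<close> (natural subtraction truncates).
\<close>

definition signed_coeff :: "nat \<Rightarrow> 'a::field_char_0 poly \<Rightarrow> nat \<Rightarrow> 'a" where
  "signed_coeff n p i = (-1) ^ i * coeff p (n - i)"

definition finite_free_add ::
    "nat \<Rightarrow> 'a::field_char_0 poly \<Rightarrow> 'a poly \<Rightarrow> 'a poly" where
  "finite_free_add n p q =
     (\<Sum>k\<in>{0..n}. monom ((-1) ^ k *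
        (\<Sum>(i, j)\<in>{(i, j). i \<le> k \<and> j \<le> k \<and> i + j = k}.
           (fact (n - i) * fact (n - j)) / (fact n * fact (n - k)) *
           signed_coeff n p i * signed_coeff n q j)) (n - k))"

definition finite_free_mult ::
    "nat \<Rightarrow> 'a::field_char_0 poly \<Rightarrow> 'a poly \<Rightarrow> 'a poly" where
  "finite_free_mult n p q =
     (\<Sum>i\<in>{0..n}. monom ((-1) ^ i *
        (signed_coeff n p i * signed_coeff n q i / of_nat (n choose i))) (n - i))"

definition real_rooted :: "complex poly \<Rightarrow> bool" where
  "real_rooted p \<longleftrightarrow> (\<forall>z. poly p z = 0 \<longrightarrow> z \<in> \<real>)"

text \<open>Sanity check: the signed coefficients do expand \<open>p\<close>.\<close>

lemma signed_coeff_expansion: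
  assumes "degree p \<le> n"
  shows "p = (\<Sum>i\<in>{0..n}. monom ((-1) ^ i * signed_coeff n p i) (n - i))"
proof -
  have "p = (\<Sum>i\<le>n. monom (coeff p i) i)"
    using poly_as_sum_of_monoms'[OF assms] by simp
  also have "\<dots> = (\<Sum>i\<in>{0..n}. monom (coeff p (n - i)) (n - i))"
    by (rule sum.reindex_bij_witness[where i = "\<lambda>i. n - i" and j = "\<lambda>i. n - i"]) auto
  also have "\<dots> = (\<Sum>i\<in>{0..n}. monom ((-1) ^ i * signed_coeff n p i) (n - i))"
    by (simp add: signed_coeff_def mult.assoc[symmetric] flip: power_add mult_2)
  finally show ?thesis .
qed

end

theory Submission
  imports Defs "HOL-Computational_Algebra.Fundamental_Theorem_Algebra"
begin

text \<open>
  Both convolutions, evaluated at \<open>x\<close>, are the Bombieri pairing \<open>\<Sum>F\<^sub>i G\<^sub>i / (n choose i)\<close> of two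
  products \<open>F\<close>, \<open>G\<close> of \<open>n\<close> real linear forms, and the convolutions of the squares are the pairing of
  \<open>F\<^sup>2\<close> and \<open>G\<^sup>2\<close> in degree \<open>2n\<close>. So it suffices that the pairing of \<open>F\<^sup>2\<close> and \<open>G\<^sup>2\<close> is at most the
  square of the pairing of \<open>F\<close> and \<open>G\<close>.

  The square equals the pairing of \<open>F \<otimes> F\<close> and \<open>G \<otimes> G\<close>, where \<open>F \<otimes> F\<close> is the bihomogeneous form
  \<open>F(x) F(y)\<close>, and the pairing of \<open>F\<^sup>2\<close> and \<open>G\<^sup>2\<close> is that of \<open>h\<close> and \<open>G \<otimes> G\<close>, where \<open>h\<close> is the component of
  \<open>F \<otimes> F\<close> killed by Cayley's operator \<open>\<Omega>\<close>. Let \<open>K\<close> be multiplication by the bracket \<open>[xy]\<close>, which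
  is adjoint to \<open>\<Omega>\<close> up to a positive factor and satisfies \<open>\<Omega> K = K \<Omega> + 2(m + 1)\<close> in degree \<open>m\<close>. With
  \<open>[ij]\<close> the bracket of the forms \<open>i\<close> and \<open>j\<close> and \<open>F\<^sub>i\<^sub>j\<close> the product \<open>F\<close> without these two,
  \<open>\<Omega> (F \<otimes> F) = - K (\<Sum>\<^sub>i\<^sub><\<^sub>j [ij]\<^sup>2 F\<^sub>i\<^sub>j \<otimes> F\<^sub>i\<^sub>j)\<close>.
  Hence \<open>F \<otimes> F - h = K\<^sup>2 y\<close>, where \<open>y\<close> solves \<open>(K \<Omega> + s) y = - \<Sum>\<^sub>i\<^sub><\<^sub>j [ij]\<^sup>2 F\<^sub>i\<^sub>j \<otimes> F\<^sub>i\<^sub>j\<close> for some \<open>s > 0\<close>,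
  and moving \<open>K\<^sup>2\<close> to the other side turns the claim into the positivity of the resolvent
  \<open>K \<Omega> (K \<Omega> + t)\<^sup>-\<^sup>1\<close> between such tensor squares, which follows by induction on the degree from the
  same identities.
\<close>

section \<open>Bihomogeneous forms, Cayley's operator and the Bombieri pairing\<close>

text \<open>
  A function \<open>u\<close> of two indices stands for the polynomial \<open>\<Sum>u i j * x^i * y^j\<close>. Then \<open>diff_mult u\<close> is
  \<open>(x - y) * u\<close>, and \<open>omega n u\<close> is \<open>n * (u\<^sub>x - u\<^sub>y) + (x - y) * u\<^sub>x\<^sub>y\<close>, the dehomogenisation of Cayley's
  operator in bidegree \<open>(n, n)\<close>.
\<close>

definition diff_mult :: "(nat \<Rightarrow> nat \<Rightarrow> real) \<Rightarrow> nat \<Rightarrow> nat \<Rightarrow> real" where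
  "diff_mult u = (\<lambda>i j. (if i = 0 then 0 else u (i - 1) j) - (if j = 0 then 0 else u i (j - 1)))"

definition omega :: "nat \<Rightarrow> (nat \<Rightarrow> nat \<Rightarrow> real) \<Rightarrow> nat \<Rightarrow> nat \<Rightarrow> real" where
  "omega n u = (\<lambda>i j. (real i + 1) * (real n - real j) * u (Suc i) j
     - (real n - real i) * (real j + 1) * u i (Suc j))"

text \<open>The operator \<open>K \<Omega>\<close>. Up to sign and an additive constant it is the
  Casimir operator of sl_2 acting diagonally on bidegree \<open>(n, n)\<close>.\<close>

definition casimir :: "nat \<Rightarrow> (nat \<Rightarrow> nat \<Rightarrow> real) \<Rightarrow> nat \<Rightarrow> nat \<Rightarrow> real" where
  "casimir n u = diff_mult (omega n u)"

definition bideg_le :: "nat \<Rightarrow> (nat \<Rightarrow> nat \<Rightarrow> real) \<Rightarrow> bool" where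
  "bideg_le n u \<longleftrightarrow> (\<forall>i j. n < i \<or> n < j \<longrightarrow> u i j = 0)"

text \<open>The Bombieri inner product in each index. Its weights make \<open>diff_mult\<close> and
  \<open>omega\<close> adjoint up to a factor.\<close>

definition pairing :: "nat \<Rightarrow> (nat \<Rightarrow> nat \<Rightarrow> real) \<Rightarrow> (nat \<Rightarrow> nat \<Rightarrow> real) \<Rightarrow> real" where
  "pairing n u v = (\<Sum>i\<le>n. \<Sum>j\<le>n. u i j * v i j / (real (n choose i) * real (n choose j)))"

definition bombieri :: "nat \<Rightarrow> real poly \<Rightarrow> real poly \<Rightarrow> real" where
  "bombieri n p q = (\<Sum>i\<le>n. coeff p i * coeff q i / real (n choose i))"

definition tensor_square :: "real poly \<Rightarrow> nat \<Rightarrow> nat \<Rightarrow> real" where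
  "tensor_square p = (\<lambda>i j. coeff p i * coeff p j)"

lemma diff_mult_sum:
  "diff_mult (\<lambda>i j. \<Sum>p\<in>A. c p * u p i j) k l = (\<Sum>p\<in>A. c p * diff_mult (u p) k l)"
  by (auto simp: diff_mult_def sum_subtractf right_diff_distrib sum_negf)

lemma omega_sum:
  "omega n (\<lambda>i j. \<Sum>p\<in>A. c p * u p i j) k l = (\<Sum>p\<in>A. c p * omega n (u p) k l)"
  by (simp add: omega_def sum_subtractf right_diff_distrib sum_distrib_left mult_ac)

lemma casimir_sum:
  "casimir n (\<lambda>i j. \<Sum>p\<in>A. c p * u p i j) k l = (\<Sum>p\<in>A. c p * casimir n (u p) k l)"
proof -
  have "omega n (\<lambda>i j. \<Sum>p\<in>A. c p * u p i j) = (\<lambda>k l. \<Sum>p\<in>A. c p * omega n (u p) k l)"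
    by (intro ext omega_sum)
  then show ?thesis
    by (simp add: casimir_def diff_mult_sum)
qed

lemma diff_mult_lincomb:
  "diff_mult (\<lambda>i j. a * u i j + b * v i j) = (\<lambda>i j. a * diff_mult u i j + b * diff_mult v i j)"
  by (auto simp: diff_mult_def algebra_simps fun_eq_iff)

lemma omega_lincomb:
  "omega n (\<lambda>i j. a * u i j + b * v i j) = (\<lambda>i j. a * omega n u i j + b * omega n v i j)"
  by (auto simp: omega_def algebra_simps fun_eq_iff)

lemma casimir_lincomb:
  "casimir n (\<lambda>i j. a * u i j + b * v i j) = (\<lambda>i j. a * casimir n u i j + b * casimir n v i j)"
  by (simp add: casimir_def omega_lincomb diff_mult_lincomb)

lemma pairing_sum_left:
  "pairing n (\<lambda>i j. \<Sum>p\<in>A. c p * u p i j) v = (\<Sum>p\<in>A. c p * pairing n (u p) v)"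
proof -
  have "pairing n (\<lambda>i j. \<Sum>p\<in>A. c p * u p i j) v =
    (\<Sum>i\<le>n. \<Sum>j\<le>n. \<Sum>p\<in>A. c p * (u p i j * v i j / (real (n choose i) * real (n choose j))))"
    unfolding pairing_def by (simp add: sum_distrib_right sum_distrib_left sum_divide_distrib mult_ac)
  also have "\<dots> = (\<Sum>p\<in>A. \<Sum>i\<le>n. \<Sum>j\<le>n. c p * (u p i j * v i j / (real (n choose i) * real (n choose j))))"
    by (simp only: sum.swap[of _ A])
  finally show ?thesis
    by (simp add: pairing_def sum_distrib_left)
qed

lemma pairing_commute: "pairing n u v = pairing n v u"
  by (simp add: pairing_def mult.commute)

lemma pairing_lincomb_left:
  "pairing n (\<lambda>i j. a * u i j + b * w i j) v = a * pairing n u v + b * pairing n w v"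
  by (simp add: pairing_def sum_distrib_left sum.distrib[symmetric] add_divide_distrib algebra_simps)

lemma pairing_tensor_square:
  "pairing n (tensor_square p) (tensor_square q) = (bombieri n p q)\<^sup>2"
  by (simp add: pairing_def tensor_square_def bombieri_def power2_eq_square sum_product mult_ac)

lemma bideg_le_sum: "(\<And>p. p \<in> A \<Longrightarrow> bideg_le n (u p)) \<Longrightarrow> bideg_le n (\<lambda>i j. \<Sum>p\<in>A. c p * u p i j)"
  by (simp add: bideg_le_def)

lemma bideg_le_lincomb:
  "bideg_le n u \<Longrightarrow> bideg_le n v \<Longrightarrow> bideg_le n (\<lambda>i j. a * u i j + b * v i j)"
  by (simp add: bideg_le_def)

lemma bideg_le_diff_mult: "bideg_le n u \<Longrightarrow> bideg_le (Suc n) (diff_mult u)"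
  by (auto simp: bideg_le_def diff_mult_def)

lemma bideg_le_tensor_square: "degree p \<le> n \<Longrightarrow> bideg_le n (tensor_square p)"
  by (auto simp: bideg_le_def tensor_square_def coeff_eq_0)

text \<open>The commutation relation of \<open>\<Omega>\<close> and \<open>K\<close>, compared
  coefficientwise. The factor \<open>1 *\<close> keeps the right side in the shape that the
  \<open>_lincomb\<close> lemmas expect.\<close>

lemma omega_diff_mult:
  "omega (Suc m) (diff_mult u) = (\<lambda>i j. 1 * casimir m u i j + (2 * real m + 2) * u i j)"
proof (intro ext)
  fix i j
  show "omega (Suc m) (diff_mult u) i j = 1 * casimir m u i j + (2 * real m + 2) * u i j"
    by (cases i; cases j) (simp_all add: omega_def diff_mult_def casimir_def algebra_simps)
qed

lemma binomial_Suc_Suc_inverse: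
  assumes "i \<le> m"
  shows "1 / real (Suc m choose Suc i) = (real i + 1) / ((real m + 1) * real (m choose i))"
proof -
  have "real (Suc i) * real (Suc m choose Suc i) = real (Suc m) * real (m choose i)"
    using Suc_times_binomial[of i m] by (metis of_nat_mult)
  moreover have "real (Suc m choose Suc i) \<noteq> 0" "real (m choose i) \<noteq> 0" "real m + 1 \<noteq> 0"
    using assms by (simp_all del: binomial_Suc_Suc)
  ultimately show ?thesis
    by (subst frac_eq_eq) (simp_all add: add.commute del: binomial_Suc_Suc)
qed

lemma binomial_Suc_inverse:
  assumes "j \<le> m"
  shows "1 / real (Suc m choose j) = (real m + 1 - real j) / ((real m + 1) * real (m choose j))"
proof -
  have "real (Suc m - j) * real (Suc m choose j) = real (Suc m) * real (m choose j)"
    using binomial_absorb_comp[of "Suc m" j] by (metis of_nat_mult diff_Suc_1)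
  moreover have "real (Suc m - j) = real m + 1 - real j"
    using assms by (simp add: of_nat_diff)
  moreover have "real (Suc m choose j) \<noteq> 0" "real (m choose j) \<noteq> 0" "real m + 1 \<noteq> 0"
    using assms by simp_all
  ultimately show ?thesis
    by (subst frac_eq_eq) (simp_all add: add.commute)
qed

text \<open>Adjointness of \<open>K\<close> and \<open>\<Omega>\<close>. After an index shift in
  both halves of \<open>diff_mult\<close>, the quotients of the binomial weights of degrees
  \<open>Suc m\<close> and \<open>m\<close> are the coefficients in
  \<open>omega (Suc m)\<close>.\<close>

lemma pairing_diff_mult:
  assumes "bideg_le m u"
  shows "pairing (Suc m) (diff_mult u) v = pairing m u (omega (Suc m) v) / (real m + 1)\<^sup>2"
proof -
  let ?c = "\<lambda>i. 1 / real (Suc m choose i)"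
  have z: "u i j = 0" if "m < i \<or> m < j" for i j
    using assms that by (auto simp: bideg_le_def)
  have "pairing (Suc m) (diff_mult u) v =
      (\<Sum>i\<le>Suc m. \<Sum>j\<le>Suc m. (if i = 0 then 0 else u (i - 1) j) * v i j * ?c i * ?c j)
    - (\<Sum>i\<le>Suc m. \<Sum>j\<le>Suc m. (if j = 0 then 0 else u i (j - 1)) * v i j * ?c i * ?c j)"
    unfolding pairing_def diff_mult_def
    by (simp only: sum_subtractf[symmetric]) (intro sum.cong refl, simp add: divide_simps algebra_simps)
  \<comment> \<open>Terms with \<open>i = 0\<close> vanish by definition, those with
    \<open>j = Suc m\<close> by the degree bound; the other half is symmetric.\<close>
  also have "(\<Sum>i\<le>Suc m. \<Sum>j\<le>Suc m. (if i = 0 then 0 else u (i - 1) j) * v i j * ?c i * ?c j)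
      = (\<Sum>i\<le>m. \<Sum>j\<le>m. u i j * v (Suc i) j * ?c (Suc i) * ?c j)"
    by (subst sum.atMost_Suc_shift) (simp add: z del: binomial_Suc_Suc)
  also have "(\<Sum>i\<le>Suc m. \<Sum>j\<le>Suc m. (if j = 0 then 0 else u i (j - 1)) * v i j * ?c i * ?c j)
      = (\<Sum>i\<le>m. \<Sum>j\<le>m. u i j * v i (Suc j) * ?c i * ?c (Suc j))"
  proof -
    have "(\<Sum>j\<le>Suc m. (if j = 0 then 0 else u i (j - 1)) * v i j * ?c i * ?c j)
      = (\<Sum>j\<le>m. u i j * v i (Suc j) * ?c i * ?c (Suc j))" for i
      by (subst sum.atMost_Suc_shift) (simp del: binomial_Suc_Suc)
    then show ?thesis
      by (simp add: z del: binomial_Suc_Suc)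
  qed
  also have "(\<Sum>i\<le>m. \<Sum>j\<le>m. u i j * v (Suc i) j * ?c (Suc i) * ?c j)
      - (\<Sum>i\<le>m. \<Sum>j\<le>m. u i j * v i (Suc j) * ?c i * ?c (Suc j))
    = (\<Sum>i\<le>m. \<Sum>j\<le>m. u i j * omega (Suc m) v i j / (real (m choose i) * real (m choose j)) / (real m + 1)\<^sup>2)"
    unfolding sum_subtractf[symmetric]
  proof (intro sum.cong refl, goal_cases)
    case (1 i j)
    then have b: "?c (Suc i) = (real i + 1) / ((real m + 1) * real (m choose i))"
      "?c (Suc j) = (real j + 1) / ((real m + 1) * real (m choose j))"
      "?c i = (real m + 1 - real i) / ((real m + 1) * real (m choose i))"
      "?c j = (real m + 1 - real j) / ((real m + 1) * real (m choose j))"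
      by (simp_all only: atMost_iff binomial_Suc_Suc_inverse binomial_Suc_inverse)
    have nz: "real (m choose i) \<noteq> 0" "real (m choose j) \<noteq> 0" "real m + 1 \<noteq> 0"
      using 1 by simp_all
    show ?case
      unfolding b omega_def using nz by (simp add: divide_simps power2_eq_square) (simp add: algebra_simps)
  qed
  finally show ?thesis
    by (simp add: pairing_def sum_divide_distrib)
qed

section \<open>Products of linear forms and the action of Cayley's operator on their tensor
  squares\<close>

text \<open>
  \<open>lin_prod a b S\<close> represents a binary form of degree \<open>card S\<close>; some of the \<open>a i\<close> may vanish, so the
  degree of the polynomial can be smaller.
\<close>

definition lin_prod :: "('a \<Rightarrow> real) \<Rightarrow> ('a \<Rightarrow> real) \<Rightarrow> 'a set \<Rightarrow> real poly" where
  "lin_prod a b S = (\<Prod>i\<in>S. [:b i, a i:])"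

definition off_diag :: "'a set \<Rightarrow> ('a \<times> 'a) set" where
  "off_diag S = {(i, j). i \<in> S \<and> j \<in> S \<and> i \<noteq> j}"

text \<open>The factor \<open>1/2\<close> compensates for summing over ordered pairs.\<close>

definition pair_weight :: "('a \<Rightarrow> real) \<Rightarrow> ('a \<Rightarrow> real) \<Rightarrow> 'a \<times> 'a \<Rightarrow> real" where
  "pair_weight a b p = - (a (fst p) * b (snd p) - b (fst p) * a (snd p))\<^sup>2 / 2"

definition remove_pair :: "'a set \<Rightarrow> 'a \<times> 'a \<Rightarrow> 'a set" where
  "remove_pair S p = S - {fst p, snd p}"

definition pair_sum :: "('a \<Rightarrow> real) \<Rightarrow> ('a \<Rightarrow> real) \<Rightarrow> 'a set \<Rightarrow> nat \<Rightarrow> nat \<Rightarrow> real" where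
  "pair_sum a b S = (\<lambda>k l. \<Sum>p\<in>off_diag S.
     pair_weight a b p * tensor_square (lin_prod a b (remove_pair S p)) k l)"

lemma pair_weight_nonpos: "pair_weight a b p \<le> 0"
  by (simp add: pair_weight_def)

lemma degree_lin_prod:
  assumes "finite S"
  shows "degree (lin_prod a b S) \<le> card S"
proof -
  have "degree (lin_prod a b S) \<le> (\<Sum>i\<in>S. degree [:b i, a i:])"
    unfolding lin_prod_def by (rule order.trans[OF degree_prod_sum_le[OF assms]]) (simp add: o_def)
  also have "\<dots> \<le> (\<Sum>i\<in>S. 1)"
    by (intro sum_mono) simp
  finally show ?thesis by simp
qed

lemma lin_prod_remove:
  assumes "finite S" "i \<in> S"
  shows "lin_prod a b S = [:b i, a i:] * lin_prod a b (S - {i})"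
  unfolding lin_prod_def using assms by (rule prod.remove)

lemma pderiv_lin_prod:
  assumes "finite S"
  shows "pderiv (lin_prod a b S) = (\<Sum>i\<in>S. smult (a i) (lin_prod a b (S - {i})))"
  unfolding lin_prod_def pderiv_prod
  by (intro sum.cong refl) (simp add: pderiv_pCons mult.commute)

lemma coeff_lin_prod_Suc:
  assumes "finite S"
  shows "(real k + 1) * coeff (lin_prod a b S) (Suc k) = (\<Sum>i\<in>S. a i * coeff (lin_prod a b (S - {i})) k)"
  using arg_cong[OF pderiv_lin_prod[OF assms], of "\<lambda>p. coeff p k" a b]
  by (simp add: coeff_pderiv coeff_sum algebra_simps)

text \<open>The derivative by the homogenising variable. Expand the product once along each of its
  factors; by \<open>coeff_lin_prod_Suc\<close> the parts with \<open>a i\<close> add up to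
  \<open>k\<close> times the coefficient.\<close>

lemma coeff_lin_prod_diff:
  assumes "finite S"
  shows "(real (card S) - real k) * coeff (lin_prod a b S) k = (\<Sum>i\<in>S. b i * coeff (lin_prod a b (S - {i})) k)"
proof -
  have "real (card S) * coeff (lin_prod a b S) k = (\<Sum>i\<in>S. coeff (lin_prod a b S) k)"
    by simp
  also have "\<dots> = (\<Sum>i\<in>S. b i * coeff (lin_prod a b (S - {i})) k
      + (if k = 0 then 0 else a i * coeff (lin_prod a b (S - {i})) (k - 1)))"
    by (intro sum.cong refl, subst lin_prod_remove[OF assms])
       (auto simp: coeff_pCons split: nat.splits)
  also have "\<dots> = (\<Sum>i\<in>S. b i * coeff (lin_prod a b (S - {i})) k) + real k * coeff (lin_prod a b S) k"
    using coeff_lin_prod_Suc[OF assms, of "k - 1" a b] by (cases k) (simp_all add: sum.distrib add.commute)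
  finally show ?thesis
    by (simp add: algebra_simps)
qed

lemma card_remove_pair:
  assumes "finite S" "p \<in> off_diag S"
  shows "card (remove_pair S p) + 2 = card S"
proof -
  have "{fst p, snd p} \<subseteq> S" "card {fst p, snd p} = 2"
    using assms(2) by (auto simp: off_diag_def)
  then show ?thesis
    using assms(1) card_Diff_subset[of "{fst p, snd p}" S] card_mono[of S "{fst p, snd p}"]
    by (simp add: remove_pair_def)
qed

text \<open>By the two derivative formulas the left side is a sum of \<open>d i j\<close> times
  \<open>P i (x) * P j (y)\<close>. As \<open>d\<close> is antisymmetric, averaging with the swapped
  sum leaves antisymmetric differences, and these are divisible by \<open>x - y\<close>.\<close>

lemma omega_tensor_square:
  assumes S: "finite S"
  shows "omega (card S) (tensor_square (lin_prod a b S)) = diff_mult (pair_sum a b S)"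
proof (intro ext)
  fix k l
  define P where "P = (\<lambda>i. lin_prod a b (S - {i}))"
  define d where "d = (\<lambda>i j. a i * b j - b i * a j)"
  have "omega (card S) (tensor_square (lin_prod a b S)) k l =
      ((real k + 1) * coeff (lin_prod a b S) (Suc k)) * ((real (card S) - real l) * coeff (lin_prod a b S) l)
    - ((real (card S) - real k) * coeff (lin_prod a b S) k) * ((real l + 1) * coeff (lin_prod a b S) (Suc l))"
    by (simp add: omega_def tensor_square_def)
  also have "\<dots> = (\<Sum>i\<in>S. \<Sum>j\<in>S. d i j * (coeff (P i) k * coeff (P j) l))"
    unfolding coeff_lin_prod_Suc[OF S] coeff_lin_prod_diff[OF S] sum_product sum_subtractf[symmetric]
    by (intro sum.cong refl) (simp add: d_def P_def algebra_simps)
  finally have 1: "omega (card S) (tensor_square (lin_prod a b S)) k l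
    = (\<Sum>i\<in>S. \<Sum>j\<in>S. d i j * (coeff (P i) k * coeff (P j) l))" .
  have 2: "(\<Sum>i\<in>S. \<Sum>j\<in>S. d i j * (coeff (P i) k * coeff (P j) l))
    = (\<Sum>i\<in>S. \<Sum>j\<in>S. - d i j * (coeff (P j) k * coeff (P i) l))"
    by (subst sum.swap) (intro sum.cong refl, simp add: d_def algebra_simps)
  have "omega (card S) (tensor_square (lin_prod a b S)) k l =
     ((\<Sum>i\<in>S. \<Sum>j\<in>S. d i j * (coeff (P i) k * coeff (P j) l))
      + (\<Sum>i\<in>S. \<Sum>j\<in>S. - d i j * (coeff (P j) k * coeff (P i) l))) / 2"
    using 1 2 by simp
  also have "\<dots> = (\<Sum>i\<in>S. \<Sum>j\<in>S. d i j * (coeff (P i) k * coeff (P j) l - coeff (P j) k * coeff (P i) l) / 2)"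
    unfolding sum.distrib[symmetric] sum_divide_distrib
    by (intro sum.cong refl) (simp add: algebra_simps)
  also have "\<dots> = (\<Sum>(i, j)\<in>S \<times> S. d i j * (coeff (P i) k * coeff (P j) l - coeff (P j) k * coeff (P i) l) / 2)"
    by (rule sum.cartesian_product)
  also have "\<dots> = (\<Sum>(i, j)\<in>off_diag S. d i j * (coeff (P i) k * coeff (P j) l - coeff (P j) k * coeff (P i) l) / 2)"
    using S by (intro sum.mono_neutral_right) (auto simp: off_diag_def d_def)
  also have "\<dots> = (\<Sum>p\<in>off_diag S. pair_weight a b p * diff_mult (tensor_square (lin_prod a b (remove_pair S p))) k l)"
  proof (intro sum.cong refl, clarify)
    fix i j assume "(i, j) \<in> off_diag S"
    then have ij: "i \<in> S" "j \<in> S" "i \<noteq> j" by (auto simp: off_diag_def)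
    define Q where "Q = lin_prod a b (remove_pair S (i, j))"
    have Pi: "P i = [:b j, a j:] * Q" and Pj: "P j = [:b i, a i:] * Q"
    proof -
      have "S - {i} - {j} = remove_pair S (i, j)" "S - {j} - {i} = remove_pair S (i, j)"
        by (auto simp: remove_pair_def)
      then show "P i = [:b j, a j:] * Q" "P j = [:b i, a i:] * Q"
        unfolding P_def Q_def
        using lin_prod_remove[of "S - {i}" j a b] lin_prod_remove[of "S - {j}" i a b] S ij
        by (metis finite_Diff insert_Diff insert_iff)+
    qed
    \<comment> \<open>With \<open>Q\<close> factored out, the difference of the two products of
      linear factors is \<open>- d i j * (x - y)\<close>.\<close>
    have "d i j * (coeff (P i) k * coeff (P j) l - coeff (P j) k * coeff (P i) l)
      = - (d i j)\<^sup>2 * diff_mult (tensor_square Q) k l"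
      unfolding Pi Pj by (cases k; cases l)
        (simp_all add: diff_mult_def tensor_square_def d_def algebra_simps power2_eq_square)
    then show "d i j * (coeff (P i) k * coeff (P j) l - coeff (P j) k * coeff (P i) l) / 2
      = pair_weight a b (i, j) * diff_mult (tensor_square (lin_prod a b (remove_pair S (i, j)))) k l"
      by (simp add: pair_weight_def d_def Q_def)
  qed
  also have "\<dots> = diff_mult (pair_sum a b S) k l"
    by (simp add: pair_sum_def diff_mult_sum)
  finally show "omega (card S) (tensor_square (lin_prod a b S)) k l = diff_mult (pair_sum a b S) k l" .
qed

lemma bideg_le_pair_sum:
  assumes "finite S" "card S = m + 2"
  shows "bideg_le m (pair_sum a b S)"
  unfolding pair_sum_def
proof (intro bideg_le_sum bideg_le_tensor_square)
  fix p assume "p \<in> off_diag S"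
  then have "card (remove_pair S p) = m"
    using card_remove_pair[OF assms(1)] assms(2) by simp
  then show "degree (lin_prod a b (remove_pair S p)) \<le> m"
    using degree_lin_prod[of "remove_pair S p"] assms(1) by (auto simp: remove_pair_def)
qed

section \<open>Positivity of the resolvent of \<open>K \<Omega>\<close>\<close>

text \<open>Moving \<open>\<Omega>\<close> past two factors \<open>K\<close> costs
  \<open>2 * (m + 2)\<close> and then \<open>2 * (m + 1)\<close>, together
  \<open>4 * m + 6\<close>.\<close>

lemma omega_diff_mult_diff_mult:
  "omega (m + 2) (diff_mult (diff_mult y))
    = diff_mult (\<lambda>i j. 1 * casimir m y i j + (4 * real m + 6) * y i j)"
proof -
  have "omega (m + 2) (diff_mult (diff_mult y)) =
     (\<lambda>i j. 1 * casimir (Suc m) (diff_mult y) i j + (2 * real (Suc m) + 2) * diff_mult y i j)"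
    using omega_diff_mult[of "Suc m" "diff_mult y"] by simp
  also have "casimir (Suc m) (diff_mult y) =
     (\<lambda>i j. 1 * diff_mult (casimir m y) i j + (2 * real m + 2) * diff_mult y i j)"
    unfolding casimir_def[of "Suc m"] omega_diff_mult diff_mult_lincomb ..
  finally show ?thesis
    unfolding diff_mult_lincomb by (simp add: algebra_simps)
qed

text \<open>By linearity \<open>y\<close> is the weighted sum of the resolvents of the tensor
  squares with two forms removed. The case \<open>0 < t\<close> drives the induction, the case
  \<open>t = 0\<close> gives the final inequality.\<close>

lemma resolvent_step:
  fixes a b :: "'a \<Rightarrow> real" and c d :: "'b \<Rightarrow> real"
  assumes S: "finite S" "card S = m + 2" and t: "0 \<le> t"
    and IH: "\<And>T. finite T \<Longrightarrow> card T = m \<Longrightarrow> \<exists>w. bideg_le m w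
      \<and> (\<forall>k l. casimir m w k l + (t + 4 * real m + 6) * w k l = tensor_square (lin_prod a b T) k l)
      \<and> (\<forall>U. finite U \<longrightarrow> card U = m \<longrightarrow> 0 \<le> pairing m (casimir m w) (tensor_square (lin_prod c d U)))"
  obtains y where "bideg_le m y"
    and "\<And>k l. casimir m y k l + (t + 4 * real m + 6) * y k l = pair_sum a b S k l"
    and "\<And>U. finite U \<Longrightarrow> card U = m + 2 \<Longrightarrow>
      0 \<le> pairing (m + 2) (diff_mult (diff_mult y)) (tensor_square (lin_prod c d U))"
proof -
  \<comment> \<open>\<open>s\<close> is the shift of the resolvent in degree \<open>m\<close>, and
    \<open>e\<close> is the constant in \<open>\<Omega> K = K \<Omega> + e\<close> there.\<close>
  define s where "s = t + 4 * real m + 6"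
  define e where "e = 2 * real m + 2"
  have se: "0 < s" "0 \<le> e" "e \<le> s"
    using t by (simp_all add: s_def e_def)
  have "\<forall>p\<in>off_diag S. \<exists>w. bideg_le m w
      \<and> (\<forall>k l. casimir m w k l + s * w k l = tensor_square (lin_prod a b (remove_pair S p)) k l)
      \<and> (\<forall>U. finite U \<longrightarrow> card U = m \<longrightarrow> 0 \<le> pairing m (casimir m w) (tensor_square (lin_prod c d U)))"
    unfolding s_def using IH S card_remove_pair[OF S(1)] by (simp add: remove_pair_def)
  then obtain w where w: "\<And>p. p \<in> off_diag S \<Longrightarrow> bideg_le m (w p)"
      "\<And>p k l. p \<in> off_diag S \<Longrightarrow>
        casimir m (w p) k l + s * w p k l = tensor_square (lin_prod a b (remove_pair S p)) k l"
      "\<And>p U. p \<in> off_diag S \<Longrightarrow> finite U \<Longrightarrow> card U = m \<Longrightarrow>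
        0 \<le> pairing m (casimir m (w p)) (tensor_square (lin_prod c d U))"
    by metis
  define y where "y = (\<lambda>k l. \<Sum>p\<in>off_diag S. pair_weight a b p * w p k l)"
  have y: "bideg_le m y"
    unfolding y_def using w(1) by (rule bideg_le_sum)
  have eq: "casimir m y k l + s * y k l = pair_sum a b S k l" for k l
    unfolding y_def casimir_sum pair_sum_def sum_distrib_left sum.distrib[symmetric]
    by (intro sum.cong refl) (simp add: algebra_simps flip: w(2))
  \<comment> \<open>The equation for \<open>w p\<close> trades \<open>e * w p\<close> for the tensor
    square and \<open>K \<Omega>\<close> of \<open>w p\<close>. Both coefficients are nonnegative
    because \<open>0 \<le> e \<le> s\<close>; the first pairing is then a square, the second is
    covered by \<open>IH\<close>.\<close>
  have shift: "(\<lambda>k l. 1 * casimir m (w p) k l + e * w p k l) =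
      (\<lambda>k l. e / s * tensor_square (lin_prod a b (remove_pair S p)) k l + (1 - e / s) * casimir m (w p) k l)"
    if "p \<in> off_diag S" for p
    using se by (simp add: field_simps fun_eq_iff flip: w(2)[OF that])
  have nonneg: "0 \<le> pairing m (\<lambda>k l. 1 * casimir m (w p) k l + e * w p k l) (tensor_square (lin_prod c d U))"
    if "p \<in> off_diag S" "finite U" "card U = m" for p U
    unfolding shift[OF that(1)] pairing_lincomb_left pairing_tensor_square
    using w(3)[OF that] se by (intro add_nonneg_nonneg mult_nonneg_nonneg) simp_all
  have "0 \<le> pairing (m + 2) (diff_mult (diff_mult y)) (tensor_square (lin_prod c d U))"
    if U: "finite U" "card U = m + 2" for U
  proof -
    \<comment> \<open>One \<open>K\<close> moves right and turns \<open>G \<otimes> G\<close> into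
      \<open>K\<close> of a pair sum; that \<open>K\<close> moves back and turns \<open>K y\<close>
      into \<open>\<Omega> K y = (K \<Omega> + e) y\<close>.\<close>
    have "pairing (m + 2) (diff_mult (diff_mult y)) (tensor_square (lin_prod c d U))
      = pairing (Suc m) (diff_mult y) (omega (card U) (tensor_square (lin_prod c d U))) / (real m + 2)\<^sup>2"
      using pairing_diff_mult[OF bideg_le_diff_mult[OF y]] U by (simp add: add.commute)
    also have "\<dots> = pairing (Suc m) (diff_mult (pair_sum c d U)) (diff_mult y) / (real m + 2)\<^sup>2"
      by (simp only: omega_tensor_square[OF U(1)] pairing_commute)
    also have "\<dots> = pairing m (pair_sum c d U) (omega (Suc m) (diff_mult y)) / (real m + 1)\<^sup>2 / (real m + 2)\<^sup>2"
      by (simp only: pairing_diff_mult[OF bideg_le_pair_sum[OF U]])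
    also have "omega (Suc m) (diff_mult y) =
        (\<lambda>k l. \<Sum>p\<in>off_diag S. pair_weight a b p * (1 * casimir m (w p) k l + e * w p k l))"
      unfolding omega_diff_mult e_def[symmetric] unfolding y_def casimir_sum
      by (simp add: fun_eq_iff sum_distrib_left sum.distrib[symmetric] algebra_simps)
    also have "pairing m (pair_sum c d U) \<dots> = (\<Sum>q\<in>off_diag U. \<Sum>p\<in>off_diag S.
        (pair_weight c d q * pair_weight a b p) *
        pairing m (\<lambda>k l. 1 * casimir m (w p) k l + e * w p k l) (tensor_square (lin_prod c d (remove_pair U q))))"
      unfolding pair_sum_def pairing_sum_left
      by (subst pairing_commute) (simp only: pairing_sum_left sum_distrib_left mult.assoc)
    finally have eq: "pairing (m + 2) (diff_mult (diff_mult y)) (tensor_square (lin_prod c d U))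
      = (\<Sum>q\<in>off_diag U. \<Sum>p\<in>off_diag S. (pair_weight c d q * pair_weight a b p) *
        pairing m (\<lambda>k l. 1 * casimir m (w p) k l + e * w p k l) (tensor_square (lin_prod c d (remove_pair U q))))
        / (real m + 1)\<^sup>2 / (real m + 2)\<^sup>2" .
    show ?thesis
      \<comment> \<open>Each term carries two nonpositive weights, so their product is
        nonnegative.\<close>
      unfolding eq using card_remove_pair[OF U(1)] U
      by (intro divide_nonneg_nonneg sum_nonneg mult_nonneg_nonneg mult_nonpos_nonpos pair_weight_nonpos nonneg)
         (auto simp: remove_pair_def)
  qed
  with y eq show ?thesis
    by (intro that[of y]) (simp_all add: s_def)
qed

text \<open>
  The solution is \<open>w = (F \<otimes> F - K\<^sup>2 y) / t\<close>, with \<open>y\<close> as in \<open>resolvent_step\<close>.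
\<close>

lemma resolvent_exists:
  fixes a b :: "'a \<Rightarrow> real" and c d :: "'b \<Rightarrow> real"
  assumes "finite S" "card S = n" "0 < t"
  shows "\<exists>w. bideg_le n w
      \<and> (\<forall>k l. casimir n w k l + t * w k l = tensor_square (lin_prod a b S) k l)
      \<and> (\<forall>U. finite U \<longrightarrow> card U = n \<longrightarrow> 0 \<le> pairing n (casimir n w) (tensor_square (lin_prod c d U)))"
  using assms
proof (induction n arbitrary: S t rule: less_induct)
  case (less n)
  define F where "F = tensor_square (lin_prod a b S)"
  have F: "bideg_le n F"
    using degree_lin_prod[OF less.prems(1), of a b] less.prems(2)
    by (auto simp: F_def intro: bideg_le_tensor_square)
  have cF: "casimir n F = diff_mult (diff_mult (pair_sum a b S))"
    using omega_tensor_square[OF less.prems(1), of a b] less.prems(2)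
    by (simp add: casimir_def F_def)
  show ?case
  proof (cases "2 \<le> n")
    case False
    \<comment> \<open>Without a pair of forms \<open>K \<Omega>\<close> kills \<open>F\<close>, and
      the resolvent is division by \<open>t\<close>.\<close>
    then have "off_diag S = {}"
      using card_remove_pair[OF less.prems(1)] less.prems(2) by fastforce
    then have c0: "casimir n F = (\<lambda>_ _. 0)"
      by (simp add: cF pair_sum_def diff_mult_def fun_eq_iff)
    have c1: "casimir n (\<lambda>i j. F i j / t) = (\<lambda>_ _. 0)"
      using casimir_lincomb[of n "1 / t" F 0 F] by (simp add: c0)
    show ?thesis
      using F less.prems(3)
      by (intro exI[of _ "\<lambda>i j. F i j / t"])
         (simp add: c1 F_def[symmetric] pairing_def, simp add: bideg_le_def)
  next
    case True
    then obtain m where n: "n = m + 2"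
      by (metis add.commute le_Suc_ex)
    obtain y where y: "bideg_le m y"
      "\<And>k l. casimir m y k l + (t + 4 * real m + 6) * y k l = pair_sum a b S k l"
      "\<And>U. finite U \<Longrightarrow> card U = m + 2 \<Longrightarrow>
        0 \<le> pairing (m + 2) (diff_mult (diff_mult y)) (tensor_square (lin_prod c d U))"
    proof (rule resolvent_step[of S m t a b c d])
      show "\<exists>w. bideg_le m w
        \<and> (\<forall>k l. casimir m w k l + (t + 4 * real m + 6) * w k l = tensor_square (lin_prod a b T) k l)
        \<and> (\<forall>U. finite U \<longrightarrow> card U = m \<longrightarrow> 0 \<le> pairing m (casimir m w) (tensor_square (lin_prod c d U)))"
        if "finite T" "card T = m" for T
        \<comment> \<open>The induction hypothesis is used with the larger shift
          \<open>t + 4 * m + 6\<close>, so \<open>t\<close> has to be arbitrary.\<close>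
        using less.prems(3) that by (intro less.IH) (simp_all add: n)
    qed (use less.prems n in auto)
    define Y where "Y = diff_mult (diff_mult y)"
    define w where "w = (\<lambda>i j. 1 / t * F i j + (- 1 / t) * Y i j)"
    have Y: "bideg_le n Y"
      using y(1) by (simp add: Y_def n bideg_le_diff_mult)
    \<comment> \<open>Here \<open>v = (K \<Omega> + 4 * m + 6) y\<close>, so
      \<open>K \<Omega> Y = K^2 v\<close>, while \<open>K \<Omega> F = K^2 (v + t * y)\<close>.
      Hence \<open>K \<Omega> (F - Y) = t * Y\<close>, and positivity for \<open>w\<close> is
      positivity for \<open>Y\<close>.\<close>
    define v where "v = (\<lambda>k l. 1 * casimir m y k l + (4 * real m + 6) * y k l)"
    have ps: "pair_sum a b S = (\<lambda>k l. 1 * v k l + t * y k l)"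
      by (simp add: v_def fun_eq_iff algebra_simps flip: y(2))
    have "casimir n Y = diff_mult (diff_mult v)"
      unfolding Y_def n v_def by (simp only: casimir_def[of "m + 2"] omega_diff_mult_diff_mult)
    then have cY: "casimir n F k l = casimir n Y k l + t * Y k l" for k l
      unfolding cF ps Y_def by (simp only: diff_mult_lincomb)
    have cw: "casimir n w = Y"
      unfolding w_def casimir_lincomb using less.prems(3) by (simp add: fun_eq_iff cY field_simps)
    have "bideg_le n w"
      unfolding w_def using F Y by (rule bideg_le_lincomb)
    moreover have "casimir n w k l + t * w k l = F k l" for k l
      unfolding cw using less.prems(3) by (simp add: w_def field_simps)
    moreover have "0 \<le> pairing n (casimir n w) (tensor_square (lin_prod c d U))"
      if "finite U" "card U = n" for U
      unfolding cw Y_def using y(3)[of U] that by (simp add: n)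
    ultimately show ?thesis
      unfolding F_def by blast
  qed
qed

section \<open>Restriction to the diagonal and the inequality for products of linear forms\<close>

text \<open>A form killed by \<open>\<Omega>\<close> is the polarisation of its restriction to the diagonal.\<close>

lemma omega_kernel:
  assumes "omega n h = (\<lambda>_ _. 0)"
  obtains e where "\<And>i j. i \<le> n \<Longrightarrow> j \<le> n \<Longrightarrow> h i j = real (n choose i) * real (n choose j) * e (i + j)"
proof -
  define g where "g = (\<lambda>i j. h i j / (real (n choose i) * real (n choose j)))"
  \<comment> \<open>After division by the binomials, the kernel equation says that the coefficients
    are constant along antidiagonals.\<close>
  have step: "g (Suc i) j = g i (Suc j)" if "i < n" "j < n" for i j
  proof -
    have A: "(real i + 1) * (real n - real j) * h (Suc i) j = (real n - real i) * (real j + 1) * h i (Suc j)"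
      using fun_cong[OF fun_cong[OF assms, of i], of j] by (simp add: omega_def)
    have B: "(real k + 1) * real (n choose Suc k) = (real n - real k) * real (n choose k)" if "k < n" for k
    proof -
      have "real (Suc k * (n choose Suc k)) = real ((n - k) * (n choose k))"
        by (simp only: binomial_absorb_comp binomial_absorption)
      then show ?thesis
        using that by (simp add: of_nat_diff algebra_simps)
    qed
    have "(real i + 1) * (real n - real j) * (h (Suc i) j * (real (n choose i) * real (n choose Suc j)))
      = (real n - real i) * (real j + 1) * h i (Suc j) * (real (n choose i) * real (n choose Suc j))"
      unfolding A[symmetric] by simp
    also have "\<dots> = h i (Suc j) * ((real n - real i) * real (n choose i)) * ((real j + 1) * real (n choose Suc j))"
      by simp
    also have "\<dots> = (real i + 1) * (real n - real j) * (h i (Suc j) * (real (n choose Suc i) * real (n choose j)))"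
      unfolding B[OF that(1), symmetric] B[OF that(2)] by simp
    finally have "h (Suc i) j * (real (n choose i) * real (n choose Suc j))
      = h i (Suc j) * (real (n choose Suc i) * real (n choose j))"
      using that by simp
    moreover have "real (n choose i) \<noteq> 0" "real (n choose j) \<noteq> 0"
      "real (n choose Suc i) \<noteq> 0" "real (n choose Suc j) \<noteq> 0"
      using that by simp_all
    ultimately show ?thesis
      by (simp add: g_def frac_eq_eq)
  qed
  \<comment> \<open>The representative of an antidiagonal is its entry with the largest second index
    allowed, \<open>min n (i + j)\<close>.\<close>
  have diag: "g i j = g (i + j - min n (i + j)) (min n (i + j))" if "i \<le> n" "j \<le> n" for i j
    using that
  proof (induction i arbitrary: j)
    case 0
    then show ?case by simp
  next
    case (Suc i)
    show ?case
    proof (cases "j = n")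
      case True
      then show ?thesis by simp
    next
      case False
      then have "g (Suc i) j = g i (Suc j)"
        using Suc.prems by (intro step) auto
      then show ?thesis
        using Suc.IH[of "Suc j"] Suc.prems False by simp
    qed
  qed
  show ?thesis
  proof (rule that[of "\<lambda>k. g (k - min n k) (min n k)"])
    fix i j assume ij: "i \<le> n" "j \<le> n"
    then have "real (n choose i) \<noteq> 0" "real (n choose j) \<noteq> 0"
      by simp_all
    then have "h i j = real (n choose i) * real (n choose j) * g i j"
      by (simp add: g_def)
    then show "h i j = real (n choose i) * real (n choose j) * g (i + j - min n (i + j)) (min n (i + j))"
      by (simp only: diag[OF ij])
  qed
qed

text \<open>The coefficients of the restriction to the diagonal \<open>x = y\<close>.\<close>

definition antidiag_sum :: "nat \<Rightarrow> (nat \<Rightarrow> nat \<Rightarrow> real) \<Rightarrow> nat \<Rightarrow> real" where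
  "antidiag_sum n u k = (\<Sum>i\<le>n. \<Sum>j\<le>n. if i + j = k then u i j else 0)"

lemma antidiag_sum_alt:
  assumes "bideg_le n u"
  shows "antidiag_sum n u k = (\<Sum>i\<le>k. u i (k - i))"
proof -
  have z: "u i j = 0" if "n < i \<or> n < j" for i j
    using assms that by (auto simp: bideg_le_def)
  have "antidiag_sum n u k = (\<Sum>i\<le>n. if i \<le> k then u i (k - i) else 0)"
    unfolding antidiag_sum_def
  proof (intro sum.cong refl)
    fix i
    have "(\<Sum>j\<le>n. if i + j = k then u i j else 0) = (\<Sum>j\<le>n. if j = k - i then (if i \<le> k then u i j else 0) else 0)"
      by (intro sum.cong) auto
    then show "(\<Sum>j\<le>n. if i + j = k then u i j else 0) = (if i \<le> k then u i (k - i) else 0)"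
      by (simp add: z)
  qed
  also have "\<dots> = (\<Sum>i\<in>{..n} \<inter> {..k}. u i (k - i))"
    by (subst sum.inter_restrict) simp_all
  also have "\<dots> = (\<Sum>i\<le>k. u i (k - i))"
    by (intro sum.mono_neutral_left) (auto simp: z, meson z not_le)
  finally show ?thesis .
qed

lemma antidiag_sum_tensor_square:
  assumes "degree p \<le> n"
  shows "antidiag_sum n (tensor_square p) k = coeff (p\<^sup>2) k"
  unfolding antidiag_sum_alt[OF bideg_le_tensor_square[OF assms]]
  by (simp add: tensor_square_def power2_eq_square coeff_mult)

text \<open>The factor \<open>x - y\<close> vanishes on the diagonal.\<close>

lemma antidiag_sum_diff_mult:
  assumes "bideg_le n u"
  shows "antidiag_sum (Suc n) (diff_mult u) k = 0"
proof (cases k)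
  case 0
  then show ?thesis
    unfolding antidiag_sum_alt[OF bideg_le_diff_mult[OF assms]] by (simp add: diff_mult_def)
next
  case (Suc k')
  have "(\<Sum>i\<le>Suc k'. if i = 0 then 0 else u (i - 1) (Suc k' - i)) = (\<Sum>i\<le>k'. u i (k' - i))"
    by (subst sum.atMost_Suc_shift) simp
  moreover have "(\<Sum>i\<le>Suc k'. if Suc k' - i = 0 then 0 else u i (Suc k' - i - 1)) = (\<Sum>i\<le>k'. u i (k' - i))"
    by simp
  ultimately show ?thesis
    unfolding antidiag_sum_alt[OF bideg_le_diff_mult[OF assms]] by (simp only: diff_mult_def Suc sum_subtractf)
qed

lemma antidiag_sum_binomial:
  assumes "k \<le> 2 * n"
  shows "antidiag_sum n (\<lambda>i j. real (n choose i) * real (n choose j) * e (i + j)) k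
    = real (2 * n choose k) * e k"
proof -
  let ?f = "\<lambda>i j. real (n choose i) * real (n choose j)"
  have "antidiag_sum n (\<lambda>i j. ?f i j * e (i + j)) k = antidiag_sum n ?f k * e k"
    by (simp add: antidiag_sum_def sum_distrib_right if_distrib[of "\<lambda>x. x * e k"] cong: if_cong sum.cong)
  also have "antidiag_sum n ?f k = (\<Sum>i\<le>k. ?f i (k - i))"
    by (rule antidiag_sum_alt) (auto simp: bideg_le_def)
  also have "\<dots> = real (\<Sum>i\<le>k. (n choose i) * (n choose (k - i)))"
    by simp
  also have "(\<Sum>i\<le>k. (n choose i) * (n choose (k - i))) = (2 * n choose k)"
    using vandermonde[of n n k] by (simp add: mult_2)
  finally show ?thesis .
qed

text \<open>The binomials in \<open>h\<close> cancel the weights, leaving a factor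
  \<open>e (i + j)\<close>, so only the diagonal restriction of \<open>v\<close> matters.
  Vandermonde's identity recovers \<open>e\<close> from that of \<open>h\<close>.\<close>

lemma pairing_omega_kernel:
  assumes h: "omega n h = (\<lambda>_ _. 0)"
  shows "pairing n h v = (\<Sum>k\<le>2 * n. antidiag_sum n h k * antidiag_sum n v k / real (2 * n choose k))"
proof -
  obtain e where e: "\<And>i j. i \<le> n \<Longrightarrow> j \<le> n \<Longrightarrow> h i j = real (n choose i) * real (n choose j) * e (i + j)"
    using omega_kernel[OF h] by blast
  have ah: "antidiag_sum n h k = real (2 * n choose k) * e k" if "k \<le> 2 * n" for k
    unfolding antidiag_sum_binomial[OF that, symmetric] antidiag_sum_def
    by (intro sum.cong refl if_cong) (simp_all add: e)
  have "pairing n h v = (\<Sum>i\<le>n. \<Sum>j\<le>n. e (i + j) * v i j)"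
    unfolding pairing_def by (intro sum.cong refl) (simp add: e)
  also have "\<dots> = (\<Sum>i\<le>n. \<Sum>j\<le>n. \<Sum>k\<le>2 * n. e k * (if i + j = k then v i j else 0))"
    by (intro sum.cong refl) (simp add: if_distrib[of "\<lambda>x. e _ * x"] cong: if_cong)
  also have "\<dots> = (\<Sum>k\<le>2 * n. e k * antidiag_sum n v k)"
    unfolding antidiag_sum_def sum_distrib_left by (simp only: sum.swap[of _ "{..2 * n}"])
  also have "\<dots> = (\<Sum>k\<le>2 * n. antidiag_sum n h k * antidiag_sum n v k / real (2 * n choose k))"
    by (intro sum.cong refl) (simp add: ah)
  finally show ?thesis .
qed

text \<open>Subtract from \<open>F \<otimes> F\<close> a form \<open>Y\<close> that vanishes on the
  diagonal, so that the rest lies in the kernel of \<open>\<Omega>\<close> and still restricts to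
  \<open>F^2\<close>. The two sides then differ by the pairing of \<open>Y\<close> with
  \<open>G \<otimes> G\<close>, which is nonnegative.\<close>

lemma bombieri_square_le:
  assumes S: "finite S" "card S = n" and U: "finite U" "card U = n"
  shows "bombieri (2 * n) ((lin_prod a b S)\<^sup>2) ((lin_prod c d U)\<^sup>2)
    \<le> (bombieri n (lin_prod a b S) (lin_prod c d U))\<^sup>2"
proof -
  let ?F = "tensor_square (lin_prod a b S)" and ?G = "tensor_square (lin_prod c d U)"
  have dF: "degree (lin_prod a b S) \<le> n" and dG: "degree (lin_prod c d U) \<le> n"
    using degree_lin_prod[OF S(1), of a b] degree_lin_prod[OF U(1), of c d] S(2) U(2) by simp_all
  have "\<exists>Y. omega n (\<lambda>i j. 1 * ?F i j + (- 1) * Y i j) = (\<lambda>_ _. 0)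
    \<and> (\<forall>k. antidiag_sum n Y k = 0) \<and> 0 \<le> pairing n Y ?G"
  proof (cases "2 \<le> n")
    case False
    then have "off_diag S = {}"
      using card_remove_pair[OF S(1)] S(2) by fastforce
    then have "omega n ?F = (\<lambda>_ _. 0)"
      using omega_tensor_square[OF S(1), of a b] S(2)
      by (simp add: pair_sum_def diff_mult_def fun_eq_iff)
    then show ?thesis
      by (intro exI[of _ "\<lambda>_ _. 0"]) (simp add: antidiag_sum_def pairing_def)
  next
    case True
    then obtain m where n: "n = m + 2"
      by (metis add.commute le_Suc_ex)
    obtain y where y: "bideg_le m y"
      "\<And>k l. casimir m y k l + (0 + 4 * real m + 6) * y k l = pair_sum a b S k l"
      "\<And>U. finite U \<Longrightarrow> card U = m + 2 \<Longrightarrow>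
        0 \<le> pairing (m + 2) (diff_mult (diff_mult y)) (tensor_square (lin_prod c d U))"
    proof (rule resolvent_step[of S m 0 a b c d])
      show "\<exists>w. bideg_le m w
        \<and> (\<forall>k l. casimir m w k l + (0 + 4 * real m + 6) * w k l = tensor_square (lin_prod a b T) k l)
        \<and> (\<forall>U. finite U \<longrightarrow> card U = m \<longrightarrow> 0 \<le> pairing m (casimir m w) (tensor_square (lin_prod c d U)))"
        if "finite T" "card T = m" for T
        using that by (intro resolvent_exists) simp_all
    qed (use S n in auto)
    \<comment> \<open>With shift \<open>t = 0\<close> the equation for \<open>y\<close> has exactly
      the constant of \<open>\<Omega> K^2\<close>, so \<open>K^2 y\<close> and
      \<open>F \<otimes> F\<close> have the same image under \<open>\<Omega>\<close>.\<close>
    have "omega n (diff_mult (diff_mult y)) = diff_mult (pair_sum a b S)"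
      unfolding n omega_diff_mult_diff_mult using y(2) by simp
    moreover have "omega n ?F = diff_mult (pair_sum a b S)"
      using omega_tensor_square[OF S(1)] S(2) by simp
    moreover have "antidiag_sum n (diff_mult (diff_mult y)) k = 0" for k
      using antidiag_sum_diff_mult[OF bideg_le_diff_mult[OF y(1)]] by (simp add: n)
    ultimately show ?thesis
      using y(3)[OF U(1)] U(2)
      by (intro exI[of _ "diff_mult (diff_mult y)"]) (simp only: omega_lincomb, simp add: n)
  qed
  then obtain Y where Y: "omega n (\<lambda>i j. 1 * ?F i j + (- 1) * Y i j) = (\<lambda>_ _. 0)"
    "\<And>k. antidiag_sum n Y k = 0" "0 \<le> pairing n Y ?G"
    by blast
  have ad: "antidiag_sum n (\<lambda>i j. 1 * ?F i j + (- 1) * Y i j) k = antidiag_sum n ?F k - antidiag_sum n Y k" for k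
    by (simp add: antidiag_sum_def sum_subtractf[symmetric]) (intro sum.cong refl, simp)
  have "bombieri (2 * n) ((lin_prod a b S)\<^sup>2) ((lin_prod c d U)\<^sup>2) = pairing n (\<lambda>i j. 1 * ?F i j + (- 1) * Y i j) ?G"
    unfolding pairing_omega_kernel[OF Y(1)] ad Y(2)
    by (simp add: bombieri_def antidiag_sum_tensor_square dF dG)
  also have "\<dots> \<le> (bombieri n (lin_prod a b S) (lin_prod c d U))\<^sup>2"
    using Y(3) by (simp only: pairing_lincomb_left pairing_tensor_square)
  finally show ?thesis .
qed

section \<open>Values of the convolutions as Bombieri pairings\<close>

lemma poly_finite_free_mult:
  fixes p q :: "real poly"
  shows "poly (finite_free_mult n p q) x = bombieri n p (smult ((-1) ^ n) (q \<circ>\<^sub>p [:0, - x:]))"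
proof -
  have "poly (finite_free_mult n p q) x = (\<Sum>i\<in>{0..n}. (-1) ^ i *
      (signed_coeff n p i * signed_coeff n q i / real (n choose i)) * x ^ (n - i))"
    by (simp add: finite_free_mult_def poly_sum poly_monom)
  also have "\<dots> = (\<Sum>m\<le>n. coeff p m * ((-1) ^ n * ((- x) ^ m * coeff q m)) / real (n choose m))"
  proof (rule sum.reindex_bij_witness[where i = "\<lambda>i. n - i" and j = "\<lambda>i. n - i"])
    fix i assume "i \<in> {0..n}"
    then have i: "i \<le> n" by simp
    then obtain m where m: "n = i + m"
      using le_Suc_ex by blast
    \<comment> \<open>The alternating sign is absorbed into the substitution of \<open>- x\<close>
      for \<open>x\<close>, up to a global \<open>(-1) ^ n\<close>.\<close>
    have "(-1) ^ n * (- x) ^ (n - i) = (-1) ^ i * x ^ (n - i)"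
      unfolding m by (cases "even i"; cases "even m") simp_all
    moreover have "(-1 :: real) ^ i * (-1) ^ i = 1"
      by (simp flip: power_mult_distrib)
    ultimately show "coeff p (n - i) * ((-1) ^ n * ((- x) ^ (n - i) * coeff q (n - i))) / real (n choose (n - i))
      = (-1) ^ i * (signed_coeff n p i * signed_coeff n q i / real (n choose i)) * x ^ (n - i)"
      by (simp add: signed_coeff_def mult_ac binomial_symmetric[OF i, symmetric])
  qed auto
  finally show ?thesis
    by (simp add: bombieri_def coeff_pcompose_linear)
qed

lemma coeff_pcompose_shift:
  fixes q :: "real poly"
  assumes "degree q \<le> n"
  shows "coeff (q \<circ>\<^sub>p [:x, 1:]) k = (\<Sum>l\<le>n. coeff q l * real (l choose k) * x ^ (l - k))"
proof -
  have c: "coeff ([:x, 1:] ^ l) k = real (l choose k) * x ^ (l - k)" for l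
  proof (cases "k \<le> l")
    case True
    then show ?thesis by (simp add: coeff_linear_poly_power)
  next
    case False
    then show ?thesis
      by (simp add: coeff_eq_0 degree_linear_power)
  qed
  have m: "monom b l \<circ>\<^sub>p r = smult b (r ^ l)" for b l and r :: "real poly"
    by (simp add: pcompose_altdef map_poly_monom poly_monom)
  have "q \<circ>\<^sub>p [:x, 1:] = (\<Sum>l\<le>n. smult (coeff q l) ([:x, 1:] ^ l))"
    by (subst poly_as_sum_of_monoms'[OF assms, symmetric]) (simp add: pcompose_sum m)
  then show ?thesis
    by (simp add: coeff_sum c mult.assoc)
qed

text \<open>The factorial weight equals \<open>((n - j) choose i) / (n choose i)\<close>, whose
  numerator comes from expanding \<open>q\<close> at the shifted argument. The exact degree of
  \<open>q\<close> makes \<open>reflect_poly\<close> reverse the coefficients in degree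
  \<open>n\<close>.\<close>

lemma poly_finite_free_add:
  fixes p q :: "real poly"
  assumes "degree q = n"
  shows "poly (finite_free_add n p q) x = bombieri n p (reflect_poly (q \<circ>\<^sub>p [:x, 1:]))"
proof -
  let ?g = "\<lambda>m l. coeff p m * (coeff q l * real (l choose (n - m)) * x ^ (l - (n - m))) / real (n choose m)"
  let ?f = "\<lambda>i j. if i + j \<le> n then x ^ (n - (i + j)) * (fact (n - i) * fact (n - j))
      / (fact n * fact (n - (i + j))) * coeff p (n - i) * coeff q (n - j) else 0"
  have "poly (finite_free_add n p q) x = (\<Sum>k\<in>{0..n}. \<Sum>(i, j)\<in>{(i, j). i \<le> k \<and> j \<le> k \<and> i + j = k}. ?f i j)"
    unfolding finite_free_add_def poly_sum poly_monom sum_distrib_left sum_distrib_right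
  proof (intro sum.cong refl, goal_cases)
    case (1 k z)
    then obtain i j where z: "z = (i, j)" and k: "k = i + j" "i + j \<le> n"
      by auto
    show ?case
      unfolding z k(1) using k(2)
      by (cases "even i"; cases "even j") (simp_all add: signed_coeff_def)
  qed
  also have "\<dots> = (\<Sum>(k, i, j)\<in>Sigma {0..n} (\<lambda>k. {(i, j). i \<le> k \<and> j \<le> k \<and> i + j = k}). ?f i j)"
  proof (rule sum.Sigma)
    have "finite {(i, j). i \<le> k \<and> j \<le> k \<and> i + j = k}" for k :: nat
      by (rule finite_subset[of _ "{..k} \<times> {..k}"]) auto
    then show "\<forall>k\<in>{0..n}. finite {(i, j). i \<le> k \<and> j \<le> k \<and> i + j = k}"
      by blast
  qed simp
  also have "\<dots> = (\<Sum>(i, j)\<in>{(i, j). i + j \<le> n}. ?f i j)"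
    by (rule sum.reindex_bij_witness[where i = "\<lambda>(i, j). (i + j, i, j)" and j = snd]) auto
  also have "\<dots> = (\<Sum>(i, j)\<in>{..n} \<times> {..n}. ?f i j)"
    by (rule sum.mono_neutral_left) (auto split: if_splits)
  also have "\<dots> = (\<Sum>(m, l)\<in>{..n} \<times> {..n}. ?g m l)"
  proof (rule sum.reindex_bij_witness[where i = "\<lambda>(i, j). (n - i, n - j)" and j = "\<lambda>(i, j). (n - i, n - j)"], goal_cases)
    case (5 z)
    obtain i j where z: "z = (i, j)" by (cases z)
    then have ij: "i \<le> n" "j \<le> n" using 5 by auto
    have b: "real (n choose (n - i)) = fact n / (fact (n - i) * fact i)"
      using ij by (subst binomial_fact) simp_all
    have "?g (n - i) (n - j) = ?f i j"
    proof (cases "i + j \<le> n")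
      case True
      have "real ((n - j) choose i) = fact (n - j) / (fact i * fact (n - (i + j)))"
        using True by (subst binomial_fact) (simp_all add: add.commute)
      then show ?thesis
        using True ij by (simp add: b) (simp add: field_simps)
    next
      \<comment> \<open>Here truncated subtraction makes the power of \<open>x\<close> equal to 1;
        it is the binomial coefficient that vanishes.\<close>
      case False
      then have "n - j < i"
        using ij by linarith
      then have "(n - j) choose i = 0"
        by (rule binomial_eq_0)
      then show ?thesis
        using False ij by simp
    qed
    then show ?case
      by (simp only: z prod.case)
  qed auto
  also have "\<dots> = bombieri n p (reflect_poly (q \<circ>\<^sub>p [:x, 1:]))"
    unfolding sum.cartesian_product[symmetric] bombieri_def
    by (intro sum.cong refl)
       (simp add: coeff_reflect_poly degree_pcompose assms not_less coeff_pcompose_shift[of q n]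
         sum_distrib_left sum_divide_distrib)
  finally show ?thesis .
qed

section \<open>The inequalities for real polynomials\<close>

text \<open>The second argument of the pairing is the product of the forms
  \<open>b i + x * y\<close> in the variable \<open>y\<close>; at \<open>x = 0\<close> their leading
  coefficients vanish, which \<open>lin_prod\<close> permits.\<close>

lemma finite_free_mult_square_le:
  fixes a b :: "nat \<Rightarrow> real" and n :: nat
  defines "p \<equiv> lin_prod (\<lambda>_. 1) (\<lambda>i. - a i) {..<n}" and "q \<equiv> lin_prod (\<lambda>_. 1) (\<lambda>i. - b i) {..<n}"
  shows "poly (finite_free_mult (2 * n) (p\<^sup>2) (q\<^sup>2)) x \<le> (poly (finite_free_mult n p q) x)\<^sup>2"
proof -
  let ?r = "lin_prod (\<lambda>_. x) b {..<n}"
  have "?r = (\<Prod>i<n. smult (-1) ([:- b i, 1:] \<circ>\<^sub>p [:0, - x:]))"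
    by (simp add: lin_prod_def pcompose_pCons)
  also have "\<dots> = smult ((-1) ^ n) (q \<circ>\<^sub>p [:0, - x:])"
    unfolding prod_smult by (simp add: q_def lin_prod_def pcompose_prod)
  finally have r: "smult ((-1) ^ n) (q \<circ>\<^sub>p [:0, - x:]) = ?r" ..
  have "smult ((-1) ^ (2 * n)) (q\<^sup>2 \<circ>\<^sub>p [:0, - x:]) = ?r\<^sup>2"
    unfolding r[symmetric] by (simp add: power2_eq_square pcompose_mult flip: power_mult_distrib)
  then show ?thesis
    unfolding poly_finite_free_mult r p_def by (simp only: bombieri_square_le[of "{..<n}" n "{..<n}"] finite_lessThan card_lessThan)
qed

text \<open>Shifting and reversing \<open>y - b i\<close> gives \<open>1 + (x - b i) * y\<close>,
  again a linear form, degenerate when \<open>x\<close> is a root of \<open>q\<close>.\<close>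

lemma finite_free_add_square_le:
  fixes a b :: "nat \<Rightarrow> real" and n :: nat
  defines "p \<equiv> lin_prod (\<lambda>_. 1) (\<lambda>i. - a i) {..<n}" and "q \<equiv> lin_prod (\<lambda>_. 1) (\<lambda>i. - b i) {..<n}"
  shows "poly (finite_free_add (2 * n) (p\<^sup>2) (q\<^sup>2)) x \<le> (poly (finite_free_add n p q) x)\<^sup>2"
proof -
  let ?r = "lin_prod (\<lambda>i. x - b i) (\<lambda>_. 1) {..<n}"
  have "reflect_poly [:x - c, 1:] = [:1, x - c:]" for c
    by (simp add: reflect_poly_pCons' monom_Suc monom_0)
  then have r: "reflect_poly (q \<circ>\<^sub>p [:x, 1:]) = ?r"
    by (simp add: q_def lin_prod_def pcompose_prod pcompose_pCons reflect_poly_prod)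
  then have r2: "reflect_poly (q\<^sup>2 \<circ>\<^sub>p [:x, 1:]) = ?r\<^sup>2"
    by (simp add: power2_eq_square pcompose_mult reflect_poly_mult)
  have "degree q = n"
    by (simp add: q_def lin_prod_def degree_prod_eq_sum_degree)
  moreover have "q \<noteq> 0"
    by (simp add: q_def lin_prod_def)
  ultimately have "degree (q\<^sup>2) = 2 * n" "degree q = n"
    by (simp_all add: degree_power_eq)
  then show ?thesis
    unfolding p_def by (simp only: poly_finite_free_add r r2 bombieri_square_le[of "{..<n}" n "{..<n}"] finite_lessThan card_lessThan)
qed

section \<open>Transfer to complex polynomials\<close>

abbreviation cpoly :: "real poly \<Rightarrow> complex poly" where
  "cpoly \<equiv> map_poly of_real"

lemma cpoly_mult: "cpoly (p * q) = cpoly p * cpoly q"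
  by (rule poly_eqI) (simp add: coeff_map_poly coeff_mult)

lemma cpoly_prod: "cpoly (\<Prod>i\<in>A. f i) = (\<Prod>i\<in>A. cpoly (f i))"
  by (induction A rule: infinite_finite_induct) (simp_all add: cpoly_mult)

lemma poly_cpoly: "poly (cpoly p) (of_real x) = of_real (poly p x)"
  by (induction p) (simp_all add: map_poly_pCons)

lemma finite_free_add_cpoly:
  "finite_free_add n (cpoly p) (cpoly q) = cpoly (finite_free_add n p q)"
  by (rule poly_eqI)
     (simp add: finite_free_add_def signed_coeff_def coeff_map_poly coeff_sum split_def
       if_distrib[of complex_of_real] cong: if_cong)

lemma finite_free_mult_cpoly:
  "finite_free_mult n (cpoly p) (cpoly q) = cpoly (finite_free_mult n p q)"
  by (rule poly_eqI)
     (simp add: finite_free_mult_def signed_coeff_def coeff_map_poly coeff_sum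
       if_distrib[of complex_of_real] cong: if_cong)

lemma real_rooted_imp_lin_prod:
  assumes "degree p = n" "lead_coeff p = 1" "real_rooted p"
  obtains a where "p = cpoly (lin_prod (\<lambda>_. 1) (\<lambda>i. - a i) {..<n})"
proof -
  obtain root where root: "p = (\<Prod>i<n. [:- root i, 1:])"
    using complex_poly_decompose'[of p] assms(1,2) by (metis smult_1_left)
  have "root i \<in> \<real>" if "i < n" for i
    using assms(3) that unfolding real_rooted_def root by (force simp: poly_prod)
  then have "[:- root i, 1:] = cpoly [:- Re (root i), 1:]" if "i < n" for i
    using that by (simp add: map_poly_pCons)
  then show ?thesis
    by (intro that[of "\<lambda>i. Re (root i)"]) (simp add: root lin_prod_def cpoly_prod)
qed

theorem theorem1p6:
  fixes n :: nat and p q :: "complex poly" and x :: real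
  assumes "degree p = n" and "lead_coeff p = 1" and "real_rooted p"
    and "degree q = n" and "lead_coeff q = 1" and "real_rooted q"
  shows "poly (finite_free_add n p q) (of_real x) \<in> \<real>
    \<and> poly (finite_free_add (2 * n) (p\<^sup>2) (q\<^sup>2)) (of_real x) \<in> \<real>
    \<and> Re ((poly (finite_free_add n p q) (of_real x))\<^sup>2)
        \<ge> Re (poly (finite_free_add (2 * n) (p\<^sup>2) (q\<^sup>2)) (of_real x))
    \<and> poly (finite_free_mult n p q) (of_real x) \<in> \<real>
    \<and> poly (finite_free_mult (2 * n) (p\<^sup>2) (q\<^sup>2)) (of_real x) \<in> \<real>
    \<and> Re ((poly (finite_free_mult n p q) (of_real x))\<^sup>2)
        \<ge> Re (poly (finite_free_mult (2 * n) (p\<^sup>2) (q\<^sup>2)) (of_real x))"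
proof -
  obtain a b where p: "p = cpoly (lin_prod (\<lambda>_. 1) (\<lambda>i. - a i) {..<n})"
    and q: "q = cpoly (lin_prod (\<lambda>_. 1) (\<lambda>i. - b i) {..<n})"
    using real_rooted_imp_lin_prod assms by metis
  have sq: "(cpoly r)\<^sup>2 = cpoly (r\<^sup>2)" for r
    by (simp add: power2_eq_square cpoly_mult)
  show ?thesis
    \<comment> \<open>All four convolutions become images of real polynomials, so their values at
      \<open>x\<close> are real and the real inequalities apply.\<close>
    unfolding p q sq finite_free_add_cpoly finite_free_mult_cpoly poly_cpoly of_real_power[symmetric]
    using finite_free_add_square_le finite_free_mult_square_le by simp
qed

end
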